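(* Let $n\ge 3$ be an integer and let $a,b,c\in\mathbb{Z}$ with $b^2=ac$. Let $f(X)=X^n+aX^2+2bX+c$ be irreducible with root $\theta$. If $p$ is a prime with $p\mid c$ and $p\nmid a$, then $p\mid I(\theta)$; in particular $f$ is non-monogenic.
   Context: Let $K=\mathbb{Q}(\theta)$ with ring of integers $\mathcal{O}_K$; $I(\theta)=[\mathcal{O}_K:\mathbb{Z}[\theta]]$ denotes the index. The polynomial $f$ is called monogenic if $I(\theta)=1$, i.e. $\mathbb{Z}[\theta]=\mathcal{O}_K$, and non-monogenic otherwise. Irreducible means irreducible over $\mathbb{Q}$. *)

theory Defs
  imports Complex_Main "HOL-Algebra.Generated_Fields" "HOL-Algebra.Algebraic_Closure_Type"
begin

(* HOL-Algebra reuses some names of the type-class based polynomial library. *)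
hide_const (open) Divisibility.irreducible Divisibility.prime up_ring.monom up_ring.coeff

abbreviation complex_ring :: "complex ring"
  where "complex_ring \<equiv> ring_of_type_algebra"

definition adjoin_rat :: "complex \<Rightarrow> complex set"
  where "adjoin_rat \<theta> = generate_field complex_ring {\<theta>}"

definition adjoin_int :: "complex \<Rightarrow> complex set"
  where "adjoin_int \<theta> = generate_ring complex_ring {\<theta>}"

definition ring_of_integers :: "complex set \<Rightarrow> complex set"
  where "ring_of_integers K = {x \<in> K. algebraic_int x}"

(* The index of additive groups: the number of cosets of \<int>[\<theta>] in the ring of integers
   of \<rat>(\<theta>). It is finite whenever \<theta> is an algebraic integer, so the convention that
   card is 0 on infinite sets plays no role there. *)
definition index :: "complex \<Rightarrow> nat"
  where "index \<theta> = card (a_rcosets\<^bsub>complex_ring\<lparr>carrier := ring_of_integers (adjoin_rat \<theta>)\<rparr>\<^esub>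
                           (adjoin_int \<theta>))"

(* Intended for monic irreducible f: its roots are conjugate and hence have the same index, so
   the choice of the root is immaterial. *)
definition monogenic :: "int poly \<Rightarrow> bool"
  where "monogenic f \<longleftrightarrow> (\<exists>\<theta>::complex. poly (map_poly of_int f) \<theta> = 0 \<and> index \<theta> = 1)"

end

theory Submission
  imports Defs "HOL-Computational_Algebra.Computational_Algebra"
begin

text \<open>
  Since \<open>p \<mid> c\<close> and \<open>p \<nmid> a\<close>, the relation \<open>b\<^sup>2 = a c\<close> forces \<open>b = p b'\<close> and \<open>c = p\<^sup>2 c'\<close>. Then
  \<open>\<alpha> = - c / (p \<theta>) = (\<theta>\<^bsup>n-1\<^esup> + a \<theta> + 2 b) / p\<close> is a root of the monic integer polynomial
  \<open>X\<^bsup>n\<^esup> - 2 b' X\<^bsup>n-1\<^esup> + a c' X\<^bsup>n-2\<^esup> + (-1)\<^bsup>n\<^esup> p\<^bsup>n-2\<^esup> c'\<^bsup>n-1\<^esup>\<close>, so it is an algebraic integer; but it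
  is not in \<open>\<int>[\<theta>]\<close>, because \<open>1, \<theta>, \<dots>, \<theta>\<^bsup>n-1\<^esup>\<close> are linearly independent over \<open>\<rat>\<close>. Hence its class
  has order \<open>p\<close> in the quotient of the ring of integers by \<open>\<int>[\<theta>]\<close>.
\<close>

section \<open>Evaluation of integer polynomials\<close>

lemma map_poly_hom_add:
  assumes "h 0 = 0" "\<And>x y. h (x + y) = h x + h y"
  shows "map_poly h (p + q) = map_poly h p + map_poly h q"
  by (rule poly_eqI) (simp add: assms coeff_map_poly)

text \<open>The map \<open>h\<close> is kept abstract so that the same facts serve
  \<open>of_int\<close> in evaluations and \<open>of_rat\<close> in the Bezout argument.\<close>

lemma map_poly_hom_mult:
  fixes h :: "'a::comm_semiring_0 \<Rightarrow> 'b::comm_semiring_0"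
  assumes "h 0 = 0" "\<And>x y. h (x + y) = h x + h y" "\<And>x y. h (x * y) = h x * h y"
  shows "map_poly h (p * q) = map_poly h p * map_poly h q"
proof (induction p)
  case (pCons a p)
  have "map_poly h (smult a q) = smult (h a) (map_poly h q)"
    by (rule poly_eqI) (simp add: assms coeff_map_poly)
  with pCons.IH show ?case
    by (simp add: mult_pCons_left map_poly_hom_add assms map_poly_pCons)
qed simp

lemma of_int_poly_simps:
  fixes p q :: "int poly" and x :: "'a::comm_ring_1"
  shows "poly (map_poly of_int (p + q)) x = poly (map_poly of_int p) x + poly (map_poly of_int q) x"
    and "poly (map_poly of_int (p * q)) x = poly (map_poly of_int p) x * poly (map_poly of_int q) x"
    and "poly (map_poly of_int (- p)) x = - poly (map_poly of_int p) x"
    and "poly (map_poly of_int (p - q)) x = poly (map_poly of_int p) x - poly (map_poly of_int q) x"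
    and "poly (map_poly of_int (smult k p)) x = of_int k * poly (map_poly of_int p) x"
    and "poly (map_poly of_int (monom k n)) x = of_int k * x ^ n"
proof -
  show add: "poly (map_poly of_int (p + q)) x = poly (map_poly of_int p) x + poly (map_poly of_int q) x"
    for p q :: "int poly"
    by (simp add: map_poly_hom_add)
  show minus: "poly (map_poly of_int (- p)) x = - poly (map_poly of_int p) x" for p :: "int poly"
    using add[of "- p" p] by (simp add: eq_neg_iff_add_eq_0)
  show "poly (map_poly of_int (p - q)) x = poly (map_poly of_int p) x - poly (map_poly of_int q) x"
    using add[of p "- q"] by (simp add: minus)
  show mult: "poly (map_poly of_int (p * q)) x = poly (map_poly of_int p) x * poly (map_poly of_int q) x"
    for p q :: "int poly"
    by (simp add: map_poly_hom_mult)
  show "poly (map_poly of_int (smult k p)) x = of_int k * poly (map_poly of_int p) x"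
    using mult[of "[:k:]" p] by (simp add: map_poly_pCons)
  show "poly (map_poly of_int (monom k n)) x = of_int k * x ^ n"
    by (simp add: map_poly_monom poly_monom)
qed

section \<open>Integer spans and the ring of algebraic integers\<close>

definition int_span :: "'a::field_char_0 set \<Rightarrow> 'a set"
  where "int_span S = {\<Sum>s\<in>S. of_int (k s) * s | k. True}"

lemma int_spanI: "x = (\<Sum>s\<in>S. of_int (k s) * s) \<Longrightarrow> x \<in> int_span S"
  unfolding int_span_def by blast

lemma int_span_add:
  assumes "x \<in> int_span S" "y \<in> int_span S"
  shows "x + y \<in> int_span S"
proof -
  obtain k l where "x = (\<Sum>s\<in>S. of_int (k s) * s)" "y = (\<Sum>s\<in>S. of_int (l s) * s)"
    using assms unfolding int_span_def by blast
  then have "x + y = (\<Sum>s\<in>S. of_int (k s + l s) * s)"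
    by (simp add: sum.distrib distrib_right)
  then show ?thesis by (rule int_spanI)
qed

lemma int_span_of_int_mult:
  assumes "x \<in> int_span S"
  shows "of_int m * x \<in> int_span S"
proof -
  obtain k where "x = (\<Sum>s\<in>S. of_int (k s) * s)"
    using assms unfolding int_span_def by blast
  then have "of_int m * x = (\<Sum>s\<in>S. of_int (m * k s) * s)"
    by (simp add: sum_distrib_left mult.assoc)
  then show ?thesis by (rule int_spanI)
qed

lemma int_span_0: "0 \<in> int_span S"
  by (rule int_spanI[where k = "\<lambda>_. 0"]) simp

lemma int_span_sum: "(\<And>i. i \<in> A \<Longrightarrow> g i \<in> int_span S) \<Longrightarrow> (\<Sum>i\<in>A. g i) \<in> int_span S"
  by (induction A rule: infinite_finite_induct) (auto simp: int_span_0 int_span_add)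

text \<open>Finiteness matters: over an infinite \<open>S\<close> the sums default to 0 and the span
  collapses to 0.\<close>

lemma int_span_incl:
  assumes "finite S" "x \<in> S"
  shows "x \<in> int_span S"
  by (rule int_spanI[where k = "\<lambda>s. if s = x then 1 else 0"])
     (use assms in \<open>simp add: if_distrib[of of_int] if_distrib[of "\<lambda>c. c * _"] cong: if_cong\<close>)

lemma mult_int_span_stable:
  assumes "\<And>s. s \<in> S \<Longrightarrow> z * s \<in> int_span S" "x \<in> int_span S"
  shows "z * x \<in> int_span S"
proof -
  obtain k where "x = (\<Sum>s\<in>S. of_int (k s) * s)"
    using assms(2) unfolding int_span_def by blast
  then have "z * x = (\<Sum>s\<in>S. of_int (k s) * (z * s))"
    by (simp add: sum_distrib_left ac_simps)
  then show ?thesis by (auto intro!: int_span_sum int_span_of_int_mult assms(1))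
qed

text \<open>
  Gaussian elimination over \<open>\<int>[X]\<close>: clearing the column of the pivot \<open>M a a\<close> from row \<open>i\<close> replaces
  \<open>M i j\<close> by \<open>M a a * M i j - M i a * M a j\<close>, which keeps the diagonal monic and of larger degree
  than the other entries.
\<close>

lemma algebraic_int_if_monic_diagonal_kernel:
  fixes z :: "'a::field_char_0" and v :: "'i \<Rightarrow> 'a" and M :: "'i \<Rightarrow> 'i \<Rightarrow> int poly"
  assumes "finite I" "d > 0"
    and "\<And>i. i \<in> I \<Longrightarrow> degree (M i i) = d \<and> lead_coeff (M i i) = 1"
    and "\<And>i j. i \<in> I \<Longrightarrow> j \<in> I \<Longrightarrow> i \<noteq> j \<Longrightarrow> degree (M i j) < d"
    and "\<And>i. i \<in> I \<Longrightarrow> (\<Sum>j\<in>I. poly (map_poly of_int (M i j)) z * v j) = 0"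
    and "k \<in> I" "v k \<noteq> 0"
  shows "algebraic_int z"
  using assms
proof (induction I arbitrary: d M k rule: finite_induct)
  case empty
  then show ?case by simp
next
  case (insert a I)
  let ?e = "\<lambda>p. poly (map_poly of_int p) z"
  have row: "?e (M i a) * v a + (\<Sum>j\<in>I. ?e (M i j) * v j) = 0" if "i \<in> insert a I" for i
    using insert.prems(4)[OF that] insert.hyps by simp
  have diag: "degree (M i i) = d" "lead_coeff (M i i) = 1" if "i \<in> insert a I" for i
    using insert.prems(2)[OF that] by auto
  have off: "degree (M i j) < d" if "i \<in> insert a I" "j \<in> insert a I" "i \<noteq> j" for i j
    using insert.prems(3)[OF that] .
  show ?case
  proof (cases "\<exists>i\<in>I. v i \<noteq> 0")
    \<comment> \<open>Only the pivot entry of \<open>v\<close> is nonzero, so row \<open>a\<close>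
      says that the monic polynomial \<open>M a a\<close> vanishes at \<open>z\<close>.\<close>
    case False
    then have "v a \<noteq> 0" using insert.prems(5,6) by auto
    moreover have "?e (M a a) * v a = 0" using row[of a] False by simp
    ultimately have "?e (M a a) = 0" by simp
    with diag(2)[of a] show ?thesis unfolding algebraic_int_altdef_ipoly by blast
  next
    case True
    then obtain l where l: "l \<in> I" "v l \<noteq> 0" by blast
    define N where "N i j = M a a * M i j - M i a * M a j" for i j
    have small: "degree (M i a * M a j) < d + d" if "i \<in> I" "j \<in> I" for i j
    proof -
      have "degree (M i a) < d" "degree (M a j) < d"
        using that insert.hyps by (auto intro!: off)
      then show ?thesis using degree_mult_le[of "M i a" "M a j"] by linarith
    qed
    have nz: "M i i \<noteq> 0" if "i \<in> insert a I" for i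
      using diag(2)[OF that] by auto
    show ?thesis
    \<comment> \<open>The degree bound doubles: \<open>M a a * M i i\<close> is monic of degree
      \<open>d + d\<close>, while every product with an off-diagonal factor has smaller
      degree.\<close>
    proof (rule insert.IH[of "d + d" N l])
      fix i assume i: "i \<in> I"
      have deg: "degree (M a a * M i i) = d + d"
        using i nz by (simp add: degree_mult_eq diag)
      have "coeff (N i i) (d + d) = lead_coeff (M a a * M i i)"
        using small[OF i i] deg by (simp add: N_def coeff_eq_0)
      also have "\<dots> = 1"
        using i by (simp add: lead_coeff_mult diag(2))
      finally have "coeff (N i i) (d + d) = 1" .
      moreover have "degree (N i i) \<le> d + d"
        unfolding N_def using small[OF i i] deg by (intro degree_diff_le) auto
      ultimately show "degree (N i i) = d + d \<and> lead_coeff (N i i) = 1"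
        using le_degree[of "N i i" "d + d"] by auto
    next
      fix i j assume ij: "i \<in> I" "j \<in> I" "i \<noteq> j"
      have "degree (M a a * M i j) < d + d"
        using degree_mult_le[of "M a a" "M i j"] off[of i j] diag(1)[of a] ij by simp
      then show "degree (N i j) < d + d"
        unfolding N_def using small[OF ij(1,2)] by (rule degree_diff_less)
    next
      fix i assume i: "i \<in> I"
      have "(\<Sum>j\<in>I. ?e (N i j) * v j)
          = ?e (M a a) * (\<Sum>j\<in>I. ?e (M i j) * v j) - ?e (M i a) * (\<Sum>j\<in>I. ?e (M a j) * v j)"
        by (simp add: N_def of_int_poly_simps sum_subtractf sum_distrib_left algebra_simps)
      also have "(\<Sum>j\<in>I. ?e (M i j) * v j) = - (?e (M i a) * v a)"
        using row[of i] i by (simp add: eq_neg_iff_add_eq_0 add.commute)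
      also have "(\<Sum>j\<in>I. ?e (M a j) * v j) = - (?e (M a a) * v a)"
        using row[of a] by (simp add: eq_neg_iff_add_eq_0 add.commute)
      finally show "(\<Sum>j\<in>I. ?e (N i j) * v j) = 0" by simp
    qed (use insert.prems(1) l in auto)
  qed
qed

text \<open>Determinant trick: if \<open>k\<close> is the integer matrix of multiplication by
  \<open>z\<close> on \<open>S\<close>, then \<open>X * 1 - k\<close> evaluated at \<open>z\<close>
  kills the vector of elements of \<open>S\<close>, which is nonzero at \<open>s0\<close>. Its
  diagonal is monic of degree 1 and its other entries are constants, so elimination applies.\<close>

lemma algebraic_int_if_int_span_stable:
  fixes S :: "'a::field_char_0 set"
  assumes "finite S" "s0 \<in> S" "s0 \<noteq> 0" and stable: "\<And>s. s \<in> S \<Longrightarrow> z * s \<in> int_span S"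
  shows "algebraic_int z"
proof -
  have "\<exists>k. z * s = (\<Sum>t\<in>S. of_int (k t) * t)" if "s \<in> S" for s
    using stable[OF that] unfolding int_span_def by blast
  then obtain k where k: "\<And>s. s \<in> S \<Longrightarrow> z * s = (\<Sum>t\<in>S. of_int (k s t) * t)"
    by metis
  define M where "M s t = [:- k s t, if s = t then 1 else 0:]" for s t
  have "(\<Sum>t\<in>S. poly (map_poly of_int (M s t)) z * t) = 0" if "s \<in> S" for s
  proof -
    have "poly (map_poly of_int (M s t)) z * t = (if s = t then z * s else 0) - of_int (k s t) * t" for t
      by (simp add: M_def map_poly_pCons algebra_simps)
    then show ?thesis using k[OF that] that \<open>finite S\<close> by (simp add: sum_subtractf)
  qed
  then show ?thesis
    using assms(1-3)
    by (intro algebraic_int_if_monic_diagonal_kernel[of S 1 M z "\<lambda>s. s" s0]) (auto simp: M_def)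
qed

lemma algebraic_int_power_reduction:
  fixes x :: "'a::field_char_0"
  assumes "algebraic_int x"
  obtains m c where "m > 0" "x ^ m = (\<Sum>i<m. of_int (c i) * x ^ i)"
proof -
  obtain p where p: "poly (map_poly of_int p) x = 0" "lead_coeff p = 1"
    using assms unfolding algebraic_int_altdef_ipoly by blast
  define m where "m = degree p"
  have "0 = (\<Sum>i\<le>m. of_int (coeff p i) * x ^ i)"
    using p(1) by (simp add: poly_altdef m_def degree_map_poly coeff_map_poly)
  also have "\<dots> = (\<Sum>i<m. of_int (coeff p i) * x ^ i) + x ^ m"
    using p(2) by (simp add: m_def flip: lessThan_Suc_atMost)
  finally have eq: "x ^ m = (\<Sum>i<m. of_int (- coeff p i) * x ^ i)"
    by (simp add: sum_negf eq_neg_iff_add_eq_0 add.commute)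
  \<comment> \<open>For \<open>m = 0\<close> the relation would read 1 = 0.\<close>
  moreover from eq have "m > 0" by (cases m) auto
  ultimately show thesis by (intro that)
qed

text \<open>The monomials \<open>x ^ i * y ^ j\<close> below the degrees of the two monic relations
  generate Z[x, y] as an additive group. A multiplication that reaches the degree bound is reduced
  by the corresponding relation.\<close>

lemma algebraic_int_common_int_span:
  fixes x y :: "'a::field_char_0"
  assumes "algebraic_int x" "algebraic_int y"
  obtains S where "finite S" "1 \<in> S" "\<And>s. s \<in> S \<Longrightarrow> x * s \<in> int_span S"
    "\<And>s. s \<in> S \<Longrightarrow> y * s \<in> int_span S"
proof -
  obtain m c where m: "m > 0" "x ^ m = (\<Sum>i<m. of_int (c i) * x ^ i)"
    using algebraic_int_power_reduction[OF assms(1)] .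
  obtain n d where n: "n > 0" "y ^ n = (\<Sum>i<n. of_int (d i) * y ^ i)"
    using algebraic_int_power_reduction[OF assms(2)] .
  define S where "S = (\<lambda>(i, j). x ^ i * y ^ j) ` ({..<m} \<times> {..<n})"
  have fin: "finite S" by (simp add: S_def)
  have mem: "x ^ i * y ^ j \<in> int_span S" if "i < m" "j < n" for i j
    using that by (intro int_span_incl[OF fin]) (auto simp: S_def)
  show thesis
  proof
    show "finite S" by fact
    show "1 \<in> S" using m(1) n(1) by (auto simp: S_def intro!: image_eqI[of _ _ "(0, 0)"])
  next
    fix s assume "s \<in> S"
    then obtain i j where ij: "i < m" "j < n" "s = x ^ i * y ^ j" by (auto simp: S_def)
    show "x * s \<in> int_span S"
    proof (cases "Suc i = m")
      case True
      then have "x * s = x ^ m * y ^ j" using ij(3) by (auto simp: ac_simps)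
      also have "\<dots> = (\<Sum>i<m. of_int (c i) * (x ^ i * y ^ j))"
        by (simp add: m(2) sum_distrib_right mult.assoc)
      finally show ?thesis
        using ij by (auto intro!: int_span_sum int_span_of_int_mult mem)
    next
      case False
      with ij mem[of "Suc i" j] show ?thesis by (simp add: mult.assoc)
    qed
    show "y * s \<in> int_span S"
    proof (cases "Suc j = n")
      case True
      then have "y * s = x ^ i * y ^ n" using ij(3) by (auto simp: ac_simps)
      also have "\<dots> = (\<Sum>j<n. of_int (d j) * (x ^ i * y ^ j))"
        by (simp add: n(2) sum_distrib_left ac_simps)
      finally show ?thesis
        using ij by (auto intro!: int_span_sum int_span_of_int_mult mem)
    next
      case False
      with ij mem[of i "Suc j"] show ?thesis by (simp add: ac_simps)
    qed
  qed
qed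

lemma algebraic_int_add:
  fixes x y :: "'a::field_char_0"
  assumes "algebraic_int x" "algebraic_int y"
  shows "algebraic_int (x + y)"
proof -
  obtain S where S: "finite S" "1 \<in> S" "\<And>s. s \<in> S \<Longrightarrow> x * s \<in> int_span S"
    "\<And>s. s \<in> S \<Longrightarrow> y * s \<in> int_span S"
    using algebraic_int_common_int_span[OF assms] by blast
  show ?thesis
    by (rule algebraic_int_if_int_span_stable[OF S(1,2)])
       (auto simp: distrib_right intro!: int_span_add S)
qed

text \<open>Multiplication by \<open>y\<close> sends generators into the span, and multiplication by
  \<open>x\<close> preserves the span, so their composite does what the determinant trick
  asks.\<close>

lemma algebraic_int_mult:
  fixes x y :: "'a::field_char_0"
  assumes "algebraic_int x" "algebraic_int y"
  shows "algebraic_int (x * y)"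
proof -
  obtain S where S: "finite S" "1 \<in> S" "\<And>s. s \<in> S \<Longrightarrow> x * s \<in> int_span S"
    "\<And>s. s \<in> S \<Longrightarrow> y * s \<in> int_span S"
    using algebraic_int_common_int_span[OF assms] by blast
  show ?thesis
    by (rule algebraic_int_if_int_span_stable[OF S(1,2)])
       (auto simp: mult.assoc intro!: mult_int_span_stable[OF S(3)] S(4))
qed

section \<open>Prime divisors of a subgroup index\<close>

text \<open>For infinite index the claim is \<open>p dvd 0\<close>.\<close>

lemma prime_dvd_card_rcosets:
  fixes G (structure)
  assumes "comm_group G"
    and "subgroup H G" "x \<in> carrier G" "x \<notin> H" "x [^] p \<in> H" "prime (p :: nat)"
  shows "p dvd card (rcosets H)"
proof -
  interpret comm_group G by fact
  interpret N: normal H G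
    using assms(2) subgroup_imp_normal by blast
  interpret Q: group "G Mod H" by (rule N.factorgroup_is_group)
  interpret h: group_hom G "G Mod H" "\<lambda>x. H #> x"
    by (unfold_locales) (rule N.r_coset_hom_Mod)
  let ?y = "H #> x"
  have y: "?y \<in> carrier (G Mod H)" using assms(3) by simp
  have "?y \<noteq> \<one>\<^bsub>G Mod H\<^esub>"
    using assms(2-4) coset_join1 by auto
  \<comment> \<open>The order of the class divides the prime \<open>p\<close> and is not 1, hence
    equals \<open>p\<close>; Lagrange's theorem concludes.\<close>
  then have "Q.ord ?y \<noteq> 1" using Q.ord_eq_1[OF y] by simp
  moreover have "?y [^]\<^bsub>G Mod H\<^esub> p = \<one>\<^bsub>G Mod H\<^esub>"
    using assms(2,3,5) by (simp add: coset_join2 flip: h.hom_nat_pow)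
  then have "Q.ord ?y dvd p" using Q.pow_eq_id[OF y] by simp
  ultimately have "Q.ord ?y = p" using assms(6) by (auto simp: prime_nat_iff)
  moreover have "Q.ord ?y dvd Coset.order (G Mod H)" by (rule Q.ord_dvd_group_order[OF y])
  ultimately show ?thesis by (simp add: Coset.order_def FactGroup_def)
qed

section \<open>The ring Z[\<theta>], the field Q(\<theta>) and the index\<close>

lemma complex_ring_simps [simp]:
  "carrier complex_ring = UNIV" "\<zero>\<^bsub>complex_ring\<^esub> = 0" "\<one>\<^bsub>complex_ring\<^esub> = 1"
  "x \<oplus>\<^bsub>complex_ring\<^esub> y = x + y" "x \<otimes>\<^bsub>complex_ring\<^esub> y = x * y"
  by (simp_all add: ring_of_type_algebra_def)

interpretation complex_ring: cring complex_ring
  by (rule cring_from_type_algebra)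

lemma complex_ring_a_inv [simp]: "\<ominus>\<^bsub>complex_ring\<^esub> x = - x"
  by (rule complex_ring.minus_equality) simp_all

lemma complex_ring_m_inv: "x \<noteq> 0 \<Longrightarrow> inv\<^bsub>complex_ring\<^esub> x = inverse x"
  by (rule complex_ring.comm_inv_char) simp_all

lemma of_int_in_adjoin_int: "of_int k \<in> adjoin_int \<theta>"
proof -
  have of_nat: "of_nat i \<in> adjoin_int \<theta>" for i
  proof (induction i)
    case 0
    show ?case
      \<comment> \<open>No generation rule yields zero directly; it arises as 1 + (-1).\<close>
      using generate_ring.eng_add[OF generate_ring.one[of complex_ring "{\<theta>}"]
          generate_ring.a_inv[OF generate_ring.one]]
      by (simp add: adjoin_int_def)
  next
    case (Suc i)
    then show ?case
      using generate_ring.eng_add[of 1 complex_ring "{\<theta>}" "of_nat i"]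
        generate_ring.one[of complex_ring "{\<theta>}"]
      by (simp add: adjoin_int_def)
  qed
  show ?thesis
    using of_nat[of "nat k"] of_nat[of "nat (- k)"]
      generate_ring.a_inv[of "of_nat (nat (- k))" complex_ring "{\<theta>}"]
    by (cases "k \<ge> 0") (auto simp: adjoin_int_def)
qed

text \<open>Replaces the inductive closure by values of integer polynomials, to which division with
  remainder applies. One inclusion follows the generation rules, the other is Horner's
  scheme.\<close>

lemma adjoin_int_eq_range: "adjoin_int \<theta> = range (\<lambda>g. poly (map_poly of_int g) \<theta>)"
proof (intro equalityI subsetI)
  fix x assume "x \<in> adjoin_int \<theta>"
  then show "x \<in> range (\<lambda>g. poly (map_poly of_int g) \<theta>)"
    unfolding adjoin_int_def
  proof (induction rule: generate_ring.induct)
    case one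
    show ?case by (rule range_eqI[of _ _ 1]) simp
  next
    case (incl h)
    then show ?case by (intro range_eqI[of _ _ "[:0, 1:]"]) (simp add: map_poly_pCons)
  next
    case (a_inv h)
    then obtain g where "h = poly (map_poly of_int g) \<theta>" by blast
    then show ?case by (intro range_eqI[of _ _ "- g"]) (simp add: of_int_poly_simps)
  next
    case (eng_add h1 h2)
    then obtain g1 g2 where "h1 = poly (map_poly of_int g1) \<theta>" "h2 = poly (map_poly of_int g2) \<theta>"
      by blast
    then show ?case by (intro range_eqI[of _ _ "g1 + g2"]) (simp add: of_int_poly_simps)
  next
    case (eng_mult h1 h2)
    then obtain g1 g2 where "h1 = poly (map_poly of_int g1) \<theta>" "h2 = poly (map_poly of_int g2) \<theta>"
      by blast
    then show ?case by (intro range_eqI[of _ _ "g1 * g2"]) (simp add: of_int_poly_simps)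
  qed
next
  fix x assume "x \<in> range (\<lambda>g. poly (map_poly of_int g) \<theta>)"
  then obtain g where "x = poly (map_poly of_int g) \<theta>" by blast
  moreover have "poly (map_poly of_int g) \<theta> \<in> adjoin_int \<theta>"
  proof (induction g)
    case 0
    show ?case using of_int_in_adjoin_int[of 0] by simp
  next
    case (pCons k g)
    then show ?case
      using of_int_in_adjoin_int[of k] generate_ring.eng_add[of _ complex_ring "{\<theta>}"]
        generate_ring.eng_mult[of \<theta> complex_ring "{\<theta>}"]
        generate_ring.incl[of \<theta> "{\<theta>}" complex_ring]
      by (simp add: adjoin_int_def map_poly_pCons)
  qed
  ultimately show "x \<in> adjoin_int \<theta>" by simp
qed

lemma adjoin_int_subset_adjoin_rat: "adjoin_int \<theta> \<subseteq> adjoin_rat \<theta>"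
proof
  fix x assume "x \<in> adjoin_int \<theta>"
  then show "x \<in> adjoin_rat \<theta>"
    unfolding adjoin_int_def adjoin_rat_def
    by (induction rule: generate_ring.induct) (blast intro: generate_field.intros)+
qed

lemma adjoin_rat_add: "x \<in> adjoin_rat \<theta> \<Longrightarrow> y \<in> adjoin_rat \<theta> \<Longrightarrow> x + y \<in> adjoin_rat \<theta>"
  using generate_field.eng_add[of x complex_ring "{\<theta>}" y] by (simp add: adjoin_rat_def)

lemma adjoin_rat_mult: "x \<in> adjoin_rat \<theta> \<Longrightarrow> y \<in> adjoin_rat \<theta> \<Longrightarrow> x * y \<in> adjoin_rat \<theta>"
  using generate_field.eng_mult[of x complex_ring "{\<theta>}" y] by (simp add: adjoin_rat_def)

lemma adjoin_rat_minus: "x \<in> adjoin_rat \<theta> \<Longrightarrow> - x \<in> adjoin_rat \<theta>"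
  using generate_field.a_inv[of x complex_ring "{\<theta>}"] by (simp add: adjoin_rat_def)

lemma adjoin_rat_inverse: "x \<in> adjoin_rat \<theta> \<Longrightarrow> inverse x \<in> adjoin_rat \<theta>"
  using generate_field.m_inv[of x complex_ring "{\<theta>}"]
  \<comment> \<open>The generation rule for inverses excludes zero; there
    \<open>inverse 0 = 0\<close> settles the claim.\<close>
  by (cases "x = 0") (simp_all add: adjoin_rat_def complex_ring_m_inv)

lemma adjoin_int_subset_ring_of_integers:
  assumes "algebraic_int \<theta>"
  shows "adjoin_int \<theta> \<subseteq> ring_of_integers (adjoin_rat \<theta>)"
proof -
  have "algebraic_int x" if "x \<in> adjoin_int \<theta>" for x
    using that unfolding adjoin_int_def
    by (induction rule: generate_ring.induct)
       (use assms in \<open>simp_all add: algebraic_int_add algebraic_int_mult int_imp_algebraic_int\<close>)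
  then show ?thesis
    using adjoin_int_subset_adjoin_rat by (auto simp: ring_of_integers_def)
qed

lemma prime_dvd_index:
  assumes "algebraic_int \<theta>" "x \<in> adjoin_rat \<theta>" "algebraic_int x" "x \<notin> adjoin_int \<theta>"
    "of_nat p * x \<in> adjoin_int \<theta>" "prime p"
  shows "p dvd index \<theta>"
proof -
  \<comment> \<open>The coset lemma is multiplicative, so the additive group of the ring of integers
    is presented as a multiplicative one; the power \<open>x [^] p\<close> then means
    \<open>p\<close> times \<open>x\<close>.\<close>
  define G where "G = add_monoid (complex_ring\<lparr>carrier := ring_of_integers (adjoin_rat \<theta>)\<rparr>)"
  have car: "carrier G = ring_of_integers (adjoin_rat \<theta>)"
    and mul: "x \<otimes>\<^bsub>G\<^esub> y = x + y" and one: "\<one>\<^bsub>G\<^esub> = 0" for x y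
    by (simp_all add: G_def)
  have sub: "adjoin_int \<theta> \<subseteq> carrier G"
    unfolding car by (rule adjoin_int_subset_ring_of_integers[OF assms(1)])
  have zero: "0 \<in> adjoin_int \<theta>"
    using of_int_in_adjoin_int[of 0] by simp
  have add: "x + y \<in> adjoin_int \<theta>" if "x \<in> adjoin_int \<theta>" "y \<in> adjoin_int \<theta>" for x y
    using that generate_ring.eng_add[of x complex_ring "{\<theta>}" y] by (simp add: adjoin_int_def)
  have minus: "- x \<in> adjoin_int \<theta>" if "x \<in> adjoin_int \<theta>" for x
    using that generate_ring.a_inv[of x complex_ring "{\<theta>}"] by (simp add: adjoin_int_def)
  have minus_car: "- x \<in> carrier G" if "x \<in> carrier G" for x
    using that by (auto simp: car ring_of_integers_def adjoin_rat_minus)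
  interpret comm_group G
  proof (rule comm_groupI)
    show "\<one>\<^bsub>G\<^esub> \<in> carrier G" using sub zero by (auto simp: one)
    show "\<exists>y\<in>carrier G. y \<otimes>\<^bsub>G\<^esub> x = \<one>\<^bsub>G\<^esub>" if "x \<in> carrier G" for x
      using minus_car[OF that] by (auto simp: mul one intro!: bexI[of _ "- x"])
  qed (auto simp: car mul one ring_of_integers_def adjoin_rat_add algebraic_int_add)
  have inv: "inv\<^bsub>G\<^esub> x = - x" if "x \<in> carrier G" for x
    using that minus_car[OF that] by (intro inv_equality) (auto simp: mul one)
  have "subgroup (adjoin_int \<theta>) G"
    by (rule subgroupI) (use sub zero inv add minus in \<open>auto simp: mul subset_iff\<close>)
  moreover have "y [^]\<^bsub>G\<^esub> k = of_nat k * y" if "y \<in> carrier G" for k :: nat and y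
    using that by (induction k) (simp_all add: one mul algebra_simps)
  then have "x [^]\<^bsub>G\<^esub> p \<in> adjoin_int \<theta>"
    using assms(2,3,5) by (simp add: car ring_of_integers_def)
  ultimately have "p dvd card (rcosets\<^bsub>G\<^esub> (adjoin_int \<theta>))"
    using assms by (intro prime_dvd_card_rcosets comm_group_axioms) (auto simp: car ring_of_integers_def)
  then show ?thesis by (simp add: index_def G_def A_RCOSETS_def)
qed

section \<open>Minimality of f, reduced representatives and divisibility of b and c\<close>

lemma irreducible_dvd_if_common_root:
  fixes F R :: "rat poly" and \<theta> :: "'a::field_char_0"
  assumes "irreducible F" "poly (map_poly of_rat F) \<theta> = 0" "poly (map_poly of_rat R) \<theta> = 0"
  shows "F dvd R"
proof (rule ccontr)
  assume "\<not> F dvd R"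
  then have "coprime F R"
    using assms(1) by (intro prime_elem_imp_coprime field_poly_irreducible_imp_prime)
  \<comment> \<open>Evaluating this Bezout identity at the common root gives 0 = 1.\<close>
  then obtain u v where "u * F + v * R = 1"
    using bezout_coefficients_fst_snd[of F R] by (metis coprime_imp_gcd_eq_1)
  then have "poly (map_poly of_rat (u * F + v * R)) \<theta> = 1" by simp
  then show False using assms(2,3) by (simp add: map_poly_hom_add map_poly_hom_mult of_rat_add of_rat_mult)
qed

lemma adjoin_int_monic_repr:
  assumes "lead_coeff f = 1" "poly (map_poly of_int f) \<theta> = 0" "x \<in> adjoin_int \<theta>"
  obtains g where "x = poly (map_poly of_int g) \<theta>" "g = 0 \<or> degree g < degree f"
proof -
  obtain g where g: "x = poly (map_poly of_int g) \<theta>"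
    using assms(3) by (auto simp: adjoin_int_eq_range)
  obtain q r where qr: "pseudo_divmod g f = (q, r)" by fastforce
  have "f \<noteq> 0" using assms(1) by auto
  \<comment> \<open>Pseudo-division scales \<open>g\<close> by a power of the leading coefficient of
    \<open>f\<close>, which is 1, so this is true division over the integers.\<close>
  from pseudo_divmod[OF this qr] assms(1) have "g = f * q + r" and r: "r = 0 \<or> degree r < degree f"
    by auto
  then have "x = poly (map_poly of_int r) \<theta>"
    using assms(2) by (simp add: g of_int_poly_simps)
  from this r show thesis by (rule that)
qed

text \<open>Once \<open>q\<close> divides \<open>b\<close>, its square divides \<open>a * c\<close>
  and is coprime to \<open>a\<close>.\<close>

lemma prime_square_dvd_if_square_eq_mult:
  fixes a b c q :: int
  assumes "b\<^sup>2 = a * c" "prime q" "q dvd c" "\<not> q dvd a"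
  shows "q dvd b" "q\<^sup>2 dvd c"
proof -
  have "q dvd b\<^sup>2" using assms(1,3) by simp
  then show "q dvd b" using assms(2) prime_dvd_power by blast
  then have "q\<^sup>2 dvd a * c" unfolding assms(1)[symmetric] by simp
  moreover have "coprime (q\<^sup>2) a"
    using assms(2,4) by (simp add: prime_imp_coprime)
  ultimately show "q\<^sup>2 dvd c" by (simp add: coprime_dvd_mult_right_iff)
qed

section \<open>The algebraic integer \<alpha> outside Z[\<theta>]\<close>

lemma prime_dvd_index_root:
  fixes n p :: nat and a b c :: int and f :: "int poly" and \<theta> :: complex
  assumes n: "n \<ge> 3" and bac: "b\<^sup>2 = a * c"
    and f: "f = monom 1 n + monom a 2 + monom (2 * b) 1 + monom c 0"
    and irr: "irreducible (map_poly rat_of_int f)"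
    and root: "poly (map_poly of_int f) \<theta> = 0"
    and p: "prime p" and pc: "int p dvd c" and pa: "\<not> int p dvd a"
  shows "p dvd index \<theta>"
proof -
  define m where "m = n - 2"
  have m: "n = Suc (Suc m)" "m \<ge> 1" using n by (auto simp: m_def)
  have coeff_f: "coeff f i = (if i = n then 1 else if i = 2 then a else
      if i = 1 then 2 * b else if i = 0 then c else 0)" for i
    using n by (auto simp: f)
  have deg: "degree f = n"
    by (rule antisym[OF degree_le le_degree]) (use n in \<open>auto simp: coeff_f\<close>)
  have lead: "lead_coeff f = 1" by (simp add: deg coeff_f)
  let ?F = "map_poly rat_of_int f"
  have degF: "degree ?F = n" by (simp add: deg degree_map_poly)
  \<comment> \<open>Otherwise X would be a proper factor of the irreducible \<open>?F\<close>, whose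
    degree is at least 3.\<close>
  have c0: "c \<noteq> 0"
  proof
    assume "c = 0"
    then have "[:0, 1:] dvd ?F"
      using n by (simp add: dvd_iff_poly_eq_0 poly_0_coeff_0 coeff_f coeff_map_poly)
    then obtain g where g: "?F = [:0, 1:] * g" by blast
    from irreducibleD[OF irr g] have "degree g = 0" by (auto simp: is_unit_poly_iff)
    with degree_mult_le[of "[:0, 1:]" g] have "degree ?F \<le> 1" by (simp add: g)
    with degF n show False by simp
  qed
  have root': "\<theta> ^ n + of_int a * \<theta>\<^sup>2 + 2 * of_int b * \<theta> + of_int c = 0"
    using root by (simp add: f of_int_poly_simps)
  have \<theta>0: "\<theta> \<noteq> 0" using root' c0 n by (auto simp: power_0_left)
  have ai\<theta>: "algebraic_int \<theta>"
    using root lead unfolding algebraic_int_altdef_ipoly by blast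
  obtain b' c' where b': "b = int p * b'" and c': "c = (int p)\<^sup>2 * c'"
    using prime_square_dvd_if_square_eq_mult[OF bac _ pc pa] p by (auto elim!: dvdE)
  have p0: "p > 0" using p prime_gt_0_nat by blast
  have c'0: "c' \<noteq> 0" using c0 c' by auto
  define \<alpha> where "\<alpha> = - (of_int (int p * c') / \<theta>)"
  have \<alpha>\<theta>: "\<alpha> * \<theta> = - (of_nat p * of_int c')" using \<theta>0 by (simp add: \<alpha>_def)
  \<comment> \<open>Found by substituting \<theta> = -p c' / \<alpha> into f(\<theta>) = 0,
    multiplying by \<open>\<alpha> ^ n\<close> and dividing by p^2 c'. The divisibility of both
    \<open>b\<close> and \<open>c\<close> makes the quotient integral and monic.\<close>
  define g where "g = monom 1 n + monom (- (2 * b')) (Suc m) + monom (a * c') m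
    + monom ((- 1) ^ n * int p ^ m * c' ^ Suc m) 0"
  have coeff_g: "coeff g i = 0" if "i > n" for i using that m by (auto simp: g_def)
  have "coeff g n = 1" using m by (auto simp: g_def)
  moreover from this have "degree g = n"
    by (intro antisym[OF degree_le le_degree]) (auto simp: coeff_g)
  ultimately have leadg: "lead_coeff g = 1" by simp
  \<comment> \<open>The substitution read backwards: both sides equal \<open>\<alpha> ^ n\<close>
    times f(\<theta>), and the factor p^2 c' is nonzero.\<close>
  have "(of_nat p)\<^sup>2 * of_int c' * poly (map_poly of_int g) \<alpha> =
      (\<alpha> * \<theta>) ^ n + of_int a * (\<alpha> * \<theta>)\<^sup>2 * \<alpha> ^ m
      + 2 * of_int b * (\<alpha> * \<theta>) * \<alpha> ^ Suc m + of_int c * \<alpha> ^ n"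
    unfolding \<alpha>\<theta>
    by (simp add: g_def of_int_poly_simps m b' c' power_mult_distrib power2_eq_square algebra_simps
        power_minus[of "of_int c' * of_nat p"])
  also have "\<dots> = \<alpha> ^ n * (\<theta> ^ n + of_int a * \<theta>\<^sup>2 + 2 * of_int b * \<theta> + of_int c)"
    by (simp add: m power_mult_distrib power2_eq_square algebra_simps)
  finally have "poly (map_poly of_int g) \<alpha> = 0" using root' p0 c'0 by simp
  then have ai\<alpha>: "algebraic_int \<alpha>"
    using leadg unfolding algebraic_int_altdef_ipoly by blast
  have "\<theta> \<in> adjoin_int \<theta>" by (simp add: adjoin_int_def generate_ring.incl)
  with of_int_in_adjoin_int[of "int p * c'" \<theta>] have \<alpha>K: "\<alpha> \<in> adjoin_rat \<theta>"
    unfolding \<alpha>_def divide_inverse using adjoin_int_subset_adjoin_rat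
    by (intro adjoin_rat_minus adjoin_rat_mult adjoin_rat_inverse) auto
  \<comment> \<open>This is (f - c) / X, so that h(\<theta>) = -c / \<theta> = p \<alpha>.\<close>
  define h where "h = monom 1 (Suc m) + monom a 1 + monom (2 * b) 0"
  have "(of_nat p * \<alpha>) * \<theta> = poly (map_poly of_int h) \<theta> * \<theta>"
  proof -
    have "(of_nat p * \<alpha>) * \<theta> = - of_int c"
      by (simp add: mult.assoc \<alpha>\<theta> c' power2_eq_square)
    also have "\<dots> = \<theta> ^ n + of_int a * \<theta>\<^sup>2 + 2 * of_int b * \<theta>"
      by (rule iffD2[OF eq_neg_iff_add_eq_0 root', symmetric])
    also have "\<dots> = poly (map_poly of_int h) \<theta> * \<theta>"
      by (simp add: h_def of_int_poly_simps m power2_eq_square algebra_simps)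
    finally show ?thesis .
  qed
  then have p\<alpha>: "of_nat p * \<alpha> = poly (map_poly of_int h) \<theta>" using \<theta>0 by simp
  have "\<alpha> \<notin> adjoin_int \<theta>"
  proof
    assume "\<alpha> \<in> adjoin_int \<theta>"
    then obtain k where k: "\<alpha> = poly (map_poly of_int k) \<theta>" "k = 0 \<or> degree k < n"
      using adjoin_int_monic_repr[OF lead root] deg by blast
    \<comment> \<open>This difference vanishes at \<theta> and has degree below \<open>n\<close>, so
      divisibility by \<open>?F\<close> forces it to be zero.\<close>
    define r where "r = h - smult (int p) k"
    have "poly (map_poly of_int r) \<theta> = 0"
      using p\<alpha> by (simp add: r_def of_int_poly_simps k(1))
    then have "poly (map_poly of_rat (map_poly rat_of_int r)) \<theta> = 0"
      by (simp add: map_poly_map_poly comp_def)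
    moreover have "poly (map_poly of_rat ?F) \<theta> = 0"
      using root by (simp add: map_poly_map_poly comp_def)
    ultimately have "?F dvd map_poly rat_of_int r"
      using irreducible_dvd_if_common_root[OF irr] by blast
    moreover have "degree r < n"
    proof -
      have "coeff r i = 0" if "i > Suc m" for i
        using that k(2) m by (auto simp: r_def h_def coeff_eq_0)
      then have "degree r \<le> Suc m" by (intro degree_le) auto
      then show ?thesis using m by simp
    qed
    ultimately have "r = 0"
      using dvd_imp_degree_le[of ?F "map_poly rat_of_int r"] degF
      by (auto simp: degree_map_poly map_poly_eq_0_iff)
    then have "coeff r (Suc m) = 0" by simp
    \<comment> \<open>Since \<open>m \<ge> 1\<close>, the leading monomial of \<open>h\<close> does
      not merge with its linear term, so its coefficient is exactly 1.\<close>
    then have "int p * coeff k (Suc m) = 1" using m by (auto simp: r_def h_def)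
    then have "int p dvd 1" by (metis dvd_triv_left)
    with p show False by (auto simp: prime_nat_iff)
  qed
  moreover have "of_nat p * \<alpha> \<in> adjoin_int \<theta>" by (simp add: p\<alpha> adjoin_int_eq_range)
  ultimately show ?thesis
    by (intro prime_dvd_index[OF ai\<theta> \<alpha>K ai\<alpha> _ _ p])
qed

theorem proposition6p5:
  fixes n p :: nat and a b c :: int and f :: "int poly" and \<theta> :: complex
  assumes "n \<ge> 3"
    and "b\<^sup>2 = a * c"
    and "f = monom 1 n + monom a 2 + monom (2 * b) 1 + monom c 0"
    and "irreducible (map_poly rat_of_int f)"
    and "poly (map_poly of_int f) \<theta> = 0"
    and "prime p"
    and "int p dvd c"
    and "\<not> int p dvd a"
  shows "p dvd index \<theta> \<and> \<not> monogenic f"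
proof -
  \<comment> \<open>Needed at every root, since \<open>monogenic\<close> lets any complex root of
    \<open>f\<close> be the witness.\<close>
  have *: "p dvd index \<eta>" if "poly (map_poly of_int f) \<eta> = 0" for \<eta>
    by (rule prime_dvd_index_root[OF assms(1-4) that assms(6-8)])
  have "\<not> p dvd 1" using assms(6) by auto
  with * assms(5) show ?thesis unfolding monogenic_def by metis
qed

end
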